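(* Let $f:[a;b]\to\mathbb{R}$ be a càdlàg function and $c>0$. The function $f^{c}$ is optimal, i.e. if $g:[a;b]\rightarrow\mathbb{R}$ is such that $\|f-g\|_{\infty}\leq c/2$ and $g$ has finite total variation, then for every $s\in[a;b]$ $$TV\left(g,[a;s]\right)\geq TV\left(f^{c},[a;s]\right).$$ Moreover, it is unique in the sense that if for every $s\in[a;b]$ the opposite inequality $$TV\left(g,[a;s]\right)\leq TV\left(f^{c},[a;s]\right)$$ holds and $c\leq\sup_{s,u\in[a;b]}|f(s)-f(u)|$, then $g=f^{c}$.
   Context: Let $-\infty<a<b<+\infty$. Càdlàg means right-continuous with left limits; $\|h\|_\infty=\sup_{t\in[a;b]}|h(t)|$; $TV(g,[a;s])=\sup_n\sup_{a\le t_0<\ldots<t_n\le s}\sum_{i=1}^n|g(t_i)-g(t_{i-1})|$ (equal to $0$ for $s=a$). Construction of $f^c$. Convention: $\inf\emptyset=\infty$, and intervals below whose right endpoint may be $\infty$ are intersected with $[a;b]$. Define $$T_D^cf=\inf\{s\in[a;b]:\sup_{t\in[a;s]}f(t)-f(s)\ge c\},\qquad T_U^cf=\inf\{s\in[a;b]:f(s)-\inf_{t\in[a;s]}f(t)\ge c\}.$$ Case $T_D^cf\ge T_U^cf$. Put $T_{D,-1}^c=a$, $T_{U,0}^c=T_U^cf$ and for $k=0,1,2,\ldots$: $T_{D,k}^c=\inf\{s\in[T_{U,k}^c;b]:\sup_{t\in[T_{U,k}^c;s]}f(t)-f(s)\ge c\}$ if $T_{U,k}^c<b$, and $T_{D,k}^c=\infty$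 if $T_{U,k}^c\ge b$; $T_{U,k+1}^c=\inf\{s\in[T_{D,k}^c;b]:f(s)-\inf_{t\in[T_{D,k}^c;s]}f(t)\ge c\}$ if $T_{D,k}^c<b$, and $T_{U,k+1}^c=\infty$ if $T_{D,k}^c\ge b$. (There is a finite $K$ with $T_{U,K}^c=\infty$ or $T_{D,K}^c=\infty$.) For $k$ with $T_{D,k-1}^c<\infty$ set $m_k^c(s)=\inf_{t\in[T_{D,k-1}^c;s]}f(t)$ for $s\in[T_{D,k-1}^c;T_{U,k}^c)$, and $m_0^c=\inf_{t\in[a;T_{U,0}^c)}f(t)$; for $k$ with $T_{U,k}^c<\infty$ set $M_k^c(s)=\sup_{t\in[T_{U,k}^c;s]}f(t)$ for $s\in[T_{U,k}^c;T_{D,k}^c)$. Define $f^c:[a;b]\to\mathbb{R}$ by $$f^c(s)=\begin{cases}m_0^c+c/2&\text{if }s\in[a;T_{U,0}^c),\\ M_k^c(s)-c/2&\text{if }s\in[T_{U,k}^c;T_{D,k}^c),\ k=0,1,2,\ldots,\\ m_{k+1}^c(s)+c/2&\text{if }s\in[T_{D,k}^c;T_{U,k+1}^c),\ k=0,1,2,\ldots.\end{cases}$$ Case $T_D^cf<T_U^cf$. Then $T_U^c(-f)=T_D^cf<T_U^cf=T_D^c(-f)$, so $-f$ satisfies $T_D^c(-f)\ge T_U^c(-f)$; let $(-f)^c$ be the function given by the definitions of the case $T_D^cf\ge T_U^cf$ (of $T_{U,k}^c$, $T_{D,k}^c$, $m_k^c(\cdot)$, $m_0^c$, $M_k^c(\cdot)$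 and $f^c$) with $f$ replaced by $-f$ throughout, and set $f^c=-(-f)^c$. *)

theory Defs
  imports "HOL-Analysis.Analysis"
begin

(* Functions on [a;b] are total functions on the reals; every notion below depends only on
   their values on {a..b}. *)

definition cadlag_on :: "real \<Rightarrow> real \<Rightarrow> (real \<Rightarrow> real) \<Rightarrow> bool" where
  "cadlag_on a b f \<longleftrightarrow>
     (\<forall>t\<in>{a..<b}. (f \<longlongrightarrow> f t) (at_right t)) \<and>
     (\<forall>t\<in>{a<..b}. \<exists>l. (f \<longlongrightarrow> l) (at_left t))"

(* Extended-real valued, so that an unbounded function has sup norm infinity. *)
definition sup_norm_on :: "real \<Rightarrow> real \<Rightarrow> (real \<Rightarrow> real) \<Rightarrow> ereal" where
  "sup_norm_on a b h = (SUP t\<in>{a..b}. ereal \<bar>h t\<bar>)"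

(* TV g a s is the total variation of g on [a;s]. The one-point partitions (n = 0) contribute
   the value 0, so that TV g a a = 0. *)
definition TV :: "(real \<Rightarrow> real) \<Rightarrow> real \<Rightarrow> real \<Rightarrow> ereal" where
  "TV g a s =
     (SUP n::nat. SUP t\<in>{t :: nat \<Rightarrow> real. strict_mono_on {0..n} t \<and> t ` {0..n} \<subseteq> {a..s}}.
        ereal (\<Sum>i=1..n. \<bar>g (t i) - g (t (i - 1))\<bar>))"

(* Times live in ereal, where Inf {} = \<infinity>. The real-valued SUP and INF below are the
   intended ones for functions that are bounded on {a..b}, as cadlag functions are. *)

(* the infimum of the s in [x;b] at which f lies at least c below its running supremum from x *)
definition drawdown_time :: "(real \<Rightarrow> real) \<Rightarrow> real \<Rightarrow> real \<Rightarrow> ereal \<Rightarrow> ereal" where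
  "drawdown_time f b c x =
     Inf (ereal ` {s. x \<le> ereal s \<and> s \<le> b \<and>
                      (SUP t\<in>{t. x \<le> ereal t \<and> t \<le> s}. f t) - f s \<ge> c})"

(* the infimum of the s in [x;b] at which f lies at least c above its running infimum from x *)
definition drawup_time :: "(real \<Rightarrow> real) \<Rightarrow> real \<Rightarrow> real \<Rightarrow> ereal \<Rightarrow> ereal" where
  "drawup_time f b c x =
     Inf (ereal ` {s. x \<le> ereal s \<and> s \<le> b \<and>
                      f s - (INF t\<in>{t. x \<le> ereal t \<and> t \<le> s}. f t) \<ge> c})"

definition T_D :: "(real \<Rightarrow> real) \<Rightarrow> real \<Rightarrow> real \<Rightarrow> real \<Rightarrow> ereal" where
  "T_D f a b c = drawdown_time f b c (ereal a)"

definition T_U :: "(real \<Rightarrow> real) \<Rightarrow> real \<Rightarrow> real \<Rightarrow> real \<Rightarrow> ereal" where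
  "T_U f a b c = drawup_time f b c (ereal a)"

definition next_TD :: "(real \<Rightarrow> real) \<Rightarrow> real \<Rightarrow> real \<Rightarrow> ereal \<Rightarrow> ereal" where
  "next_TD f b c x = (if x < ereal b then drawdown_time f b c x else \<infinity>)"

definition next_TU :: "(real \<Rightarrow> real) \<Rightarrow> real \<Rightarrow> real \<Rightarrow> ereal \<Rightarrow> ereal" where
  "next_TU f b c x = (if x < ereal b then drawup_time f b c x else \<infinity>)"

(* TU f a b c k and TD f a b c k are T_{U,k} and T_{D,k} for k = 0, 1, 2, ... *)
primrec TU :: "(real \<Rightarrow> real) \<Rightarrow> real \<Rightarrow> real \<Rightarrow> real \<Rightarrow> nat \<Rightarrow> ereal" where
  "TU f a b c 0 = T_U f a b c"
| "TU f a b c (Suc k) = next_TU f b c (next_TD f b c (TU f a b c k))"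

definition TD :: "(real \<Rightarrow> real) \<Rightarrow> real \<Rightarrow> real \<Rightarrow> real \<Rightarrow> nat \<Rightarrow> ereal" where
  "TD f a b c k = next_TD f b c (TU f a b c k)"

(* m_0, the infimum of f over [a;T_{U,0}) *)
definition m_zero :: "(real \<Rightarrow> real) \<Rightarrow> real \<Rightarrow> real \<Rightarrow> real \<Rightarrow> real" where
  "m_zero f a b c = (INF t\<in>{t\<in>{a..b}. ereal t < TU f a b c 0}. f t)"

(* m_Suc f a b c k is the function m_{k+1} on [T_{D,k};T_{U,k+1}) *)
definition m_Suc :: "(real \<Rightarrow> real) \<Rightarrow> real \<Rightarrow> real \<Rightarrow> real \<Rightarrow> nat \<Rightarrow> real \<Rightarrow> real" where
  "m_Suc f a b c k s = (INF t\<in>{t. TD f a b c k \<le> ereal t \<and> t \<le> s}. f t)"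

definition M_run :: "(real \<Rightarrow> real) \<Rightarrow> real \<Rightarrow> real \<Rightarrow> real \<Rightarrow> nat \<Rightarrow> real \<Rightarrow> real" where
  "M_run f a b c k s = (SUP t\<in>{t. TU f a b c k \<le> ereal t \<and> t \<le> s}. f t)"

definition in_upper :: "(real \<Rightarrow> real) \<Rightarrow> real \<Rightarrow> real \<Rightarrow> real \<Rightarrow> real \<Rightarrow> nat \<Rightarrow> bool" where
  "in_upper f a b c s k \<longleftrightarrow> TU f a b c k \<le> ereal s \<and> ereal s < TD f a b c k"

definition in_lower :: "(real \<Rightarrow> real) \<Rightarrow> real \<Rightarrow> real \<Rightarrow> real \<Rightarrow> real \<Rightarrow> nat \<Rightarrow> bool" where
  "in_lower f a b c s k \<longleftrightarrow> TD f a b c k \<le> ereal s \<and> ereal s < TU f a b c (Suc k)"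

(* f^c in the case T_D f >= T_U f: the intervals [a;T_{U,0}), [T_{U,k};T_{D,k}) and
   [T_{D,k};T_{U,k+1}) partition [a;b], so each index k below is unique. *)
definition fc_up_first :: "(real \<Rightarrow> real) \<Rightarrow> real \<Rightarrow> real \<Rightarrow> real \<Rightarrow> real \<Rightarrow> real" where
  "fc_up_first f a b c s =
     (if ereal s < TU f a b c 0 then m_zero f a b c + c / 2
      else if \<exists>k. in_upper f a b c s k
        then M_run f a b c (THE k. in_upper f a b c s k) s - c / 2
      else m_Suc f a b c (THE k. in_lower f a b c s k) s + c / 2)"

definition fc :: "(real \<Rightarrow> real) \<Rightarrow> real \<Rightarrow> real \<Rightarrow> real \<Rightarrow> real \<Rightarrow> real" where
  "fc f a b c s =
     (if T_D f a b c \<ge> T_U f a b c then fc_up_first f a b c s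
      else - fc_up_first (\<lambda>t. - f t) a b c s)"

end

(* Along each phase f^c is monotone: it is the running supremum of f minus c/2 or the running
   infimum plus c/2. Since g stays within c/2 of f, it follows every monotone phase of f^c at
   least as far, and any overshoot costs variation. Quantitatively, with F = f^c,
     TV(g,[a;s]) >= TV(F,[a;s]) + |g(s) - F(s)|   for all s >= T_{U,0},
   which is propagated from one stopping time to the next and gives optimality and uniqueness at
   once. On [a;T_{U,0}) the function F is constant; there uniqueness follows from the size of the
   first jump or, when T_{U,0} is infinite, from the assumption on the oscillation. If f falls by
   c before it rises by c, this is applied to -f and -g. *)
theory Submission
  imports Defs
begin

section \<open>Total variation\<close>

lemma TV_upper:
  fixes n :: nat
  assumes "strict_mono_on {0..n} t" "t ` {0..n} \<subseteq> {a..s}"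
  shows "ereal (\<Sum>i=1..n. \<bar>g (t i) - g (t (i - 1))\<bar>) \<le> TV g a s"
  unfolding TV_def using assms by (intro SUP_upper2[of n] SUP_upper2[of t]) auto

lemma TV_least:
  assumes "\<And>(n::nat) t. strict_mono_on {0..n} t \<Longrightarrow> t ` {0..n} \<subseteq> {a..s} \<Longrightarrow>
    ereal (\<Sum>i=1..n. \<bar>g (t i) - g (t (i - 1))\<bar>) \<le> B"
  shows "TV g a s \<le> B"
  unfolding TV_def by (intro SUP_least) (use assms in blast)

lemma TV_uminus: "TV (\<lambda>t. - g t) a s = TV g a s"
proof -
  have "\<bar>- x - - y\<bar> = \<bar>x - y\<bar>" for x y :: real by simp
  then show ?thesis unfolding TV_def by simp
qed

lemma TV_nonneg:
  assumes "a \<le> s" shows "0 \<le> TV g a s"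
proof -
  have "strict_mono_on {0..0::nat} (\<lambda>_. a)" by (auto intro: strict_mono_onI)
  then show ?thesis using TV_upper[of 0 "\<lambda>_. a" a s g] assms by (simp add: zero_ereal_def)
qed

text \<open>Partitions are strictly increasing, so \<open>s\<close> can be appended as a new last
  point only when it lies strictly beyond \<open>t n\<close>.\<close>

lemma TV_extend_partition:
  fixes n :: nat
  assumes "strict_mono_on {0..n} t" "t ` {0..n} \<subseteq> {a..u}" "t n < s" "u \<le> s"
  shows "ereal ((\<Sum>i=1..n. \<bar>g (t i) - g (t (i - 1))\<bar>) + \<bar>g s - g (t n)\<bar>) \<le> TV g a s"
proof -
  let ?t = "t(Suc n := s)"
  have le: "t i \<le> t n" if "i \<le> n" for i
    using strict_mono_on_leD[OF assms(1), of i n] that by simp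
  have "strict_mono_on {0..Suc n} ?t"
  proof (rule strict_mono_onI)
    fix r q assume rq: "r \<in> {0..Suc n}" "q \<in> {0..Suc n}" "r < q"
    show "?t r < ?t q"
    proof (cases "q = Suc n")
      case True
      then show ?thesis using rq le[of r] assms(3) by auto
    next
      case False
      then show ?thesis using rq strict_mono_onD[OF assms(1), of r q] by auto
    qed
  qed
  moreover have "?t ` {0..Suc n} \<subseteq> {a..s}"
    using assms(2,3,4) by (force simp: image_subset_iff le_Suc_eq)
  moreover have "(\<Sum>i=1..Suc n. \<bar>g (?t i) - g (?t (i - 1))\<bar>)
      = (\<Sum>i=1..n. \<bar>g (t i) - g (t (i - 1))\<bar>) + \<bar>g s - g (t n)\<bar>"
  proof -
    have "(\<Sum>i=1..n. \<bar>g (?t i) - g (?t (i - 1))\<bar>) = (\<Sum>i=1..n. \<bar>g (t i) - g (t (i - 1))\<bar>)"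
      by (intro sum.cong) auto
    then show ?thesis by simp
  qed
  ultimately show ?thesis using TV_upper[of "Suc n" ?t a s g] by simp
qed

text \<open>Every partition of [a;u] can be continued through \<open>u\<close> to \<open>s\<close>.
  This one-increment form of additivity makes the variation monotone in its endpoint and bounds
  increments of \<open>g\<close> by those of its variation, also when values are infinite.\<close>

lemma TV_superadditive:
  assumes "a \<le> u" "u \<le> s"
  shows "TV g a u + ereal \<bar>g s - g u\<bar> \<le> TV g a s"
proof (cases "u = s")
  case True then show ?thesis by simp
next
  case False
  then have us: "u < s" using assms by simp
  have "TV g a u \<le> TV g a s - ereal \<bar>g s - g u\<bar>"
  proof (rule TV_least)
    fix n and t :: "nat \<Rightarrow> real"
    assume t: "strict_mono_on {0..n} t" "t ` {0..n} \<subseteq> {a..u}"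
    let ?S = "\<Sum>i=1..n. \<bar>g (t i) - g (t (i - 1))\<bar>"
    have tn: "t n \<le> u" using t(2) by (auto simp: image_subset_iff)
    have "ereal (?S + \<bar>g s - g u\<bar>) \<le> TV g a s"
    \<comment> \<open>The partition has to pass through \<open>u\<close> before \<open>s\<close> is
      appended. If it already ends in \<open>u\<close>, strictness forbids adding \<open>u\<close>
      again; otherwise \<open>u\<close> is inserted and the extra nonnegative increment is
      dropped.\<close>
    proof (cases "t n = u")
      case True
      then show ?thesis using TV_extend_partition[OF t, of s g] us by simp
    next
      case False
      let ?t = "t(Suc n := u)"
      have le: "t i \<le> t n" if "i \<le> n" for i
        using strict_mono_on_leD[OF t(1), of i n] that by simp
      have mono: "strict_mono_on {0..Suc n} ?t"
      proof (rule strict_mono_onI)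
        fix r q assume rq: "r \<in> {0..Suc n}" "q \<in> {0..Suc n}" "r < q"
        show "?t r < ?t q"
        proof (cases "q = Suc n")
          case True
          then show ?thesis using rq le[of r] tn False \<open>t n \<noteq> u\<close> by auto
        next
          case False
          then show ?thesis using rq strict_mono_onD[OF t(1), of r q] by auto
        qed
      qed
      have sub: "?t ` {0..Suc n} \<subseteq> {a..u}"
        using t(2) assms(1) by (force simp: image_subset_iff le_Suc_eq)
      have "(\<Sum>i=1..n. \<bar>g (?t i) - g (?t (i - 1))\<bar>) = ?S"
        by (intro sum.cong) auto
      then have "ereal (?S + \<bar>g u - g (t n)\<bar> + \<bar>g s - g u\<bar>) \<le> TV g a s"
        using TV_extend_partition[OF mono sub, of s g] us by simp
      then show ?thesis by (rule order_trans[rotated]) simp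
    qed
    then show "ereal ?S \<le> TV g a s - ereal \<bar>g s - g u\<bar>"
      by (simp add: ereal_le_minus)
  qed
  then show ?thesis by (simp add: ereal_le_minus)
qed

text \<open>The increments of \<open>v\<close> telescope along a partition, and \<open>v\<close> is
  nondecreasing because its increments dominate absolute values. All upper bounds on the variation
  of f^c come from a suitable \<open>v\<close>.\<close>

lemma TV_le_dominating:
  assumes "\<And>t t'. a \<le> t \<Longrightarrow> t \<le> t' \<Longrightarrow> t' \<le> s \<Longrightarrow> \<bar>h t' - h t\<bar> \<le> v t' - v t" "a \<le> s"
  shows "TV h a s \<le> ereal (v s - v a)"
proof (rule TV_least)
  fix n and t :: "nat \<Rightarrow> real"
  assume t: "strict_mono_on {0..n} t" "t ` {0..n} \<subseteq> {a..s}"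
  have "m \<le> n \<Longrightarrow> (\<Sum>i=1..m. \<bar>h (t i) - h (t (i - 1))\<bar>) \<le> v (t m) - v (t 0)" for m
  proof (induction m)
    case (Suc m)
    have "\<bar>h (t (Suc m)) - h (t m)\<bar> \<le> v (t (Suc m)) - v (t m)"
      using assms(1)[of "t m" "t (Suc m)"] strict_mono_onD[OF t(1), of m "Suc m"] t(2) Suc.prems
      by (force simp: image_subset_iff)
    then show ?case using Suc by simp
  qed simp
  from this[of n] have "(\<Sum>i=1..n. \<bar>h (t i) - h (t (i - 1))\<bar>) \<le> v (t n) - v (t 0)" by simp
  also have "\<dots> \<le> v s - v a"
  proof -
    have r: "t 0 \<in> {a..s}" "t n \<in> {a..s}" using t(2) by (simp_all add: image_subset_iff)
    have "0 \<le> v s - v (t n)" using assms(1)[of "t n" s] r by force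
    moreover have "0 \<le> v (t 0) - v a" using assms(1)[of a "t 0"] r by force
    ultimately show ?thesis by simp
  qed
  finally show "ereal (\<Sum>i=1..n. \<bar>h (t i) - h (t (i - 1))\<bar>) \<le> ereal (v s - v a)" by simp
qed

text \<open>The variation of \<open>h\<close> up to \<open>x\<close> and the majorant
  \<open>v\<close> after \<open>x\<close> are glued into one dominating function; an increment
  across \<open>x\<close> is split there by the triangle inequality.\<close>

lemma TV_extend_le:
  assumes "TV h a x \<le> ereal B" "a \<le> x" "x \<le> y"
    and v: "\<And>t t'. x \<le> t \<Longrightarrow> t \<le> t' \<Longrightarrow> t' \<le> y \<Longrightarrow> \<bar>h t' - h t\<bar> \<le> v t' - v t"
  shows "TV h a y \<le> ereal (B + (v y - v x))"
proof -
  define V where "V t = (if t \<le> x then real_of_ereal (TV h a t)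
    else real_of_ereal (TV h a x) + (v t - v x))" for t
  \<comment> \<open>\<open>real_of_ereal\<close> sends infinity to 0, so \<open>V\<close> has the
    intended meaning only for finite values. Superadditivity brings the bound at \<open>x\<close>
    down to all earlier \<open>t\<close>.\<close>
  have fin: "\<exists>r. TV h a t = ereal r" if "a \<le> t" "t \<le> x" for t
  proof -
    have "TV h a t + ereal \<bar>h x - h t\<bar> \<le> ereal B"
      using TV_superadditive[OF that, of h] assms(1) by (rule order_trans)
    moreover have "0 \<le> TV h a t" using TV_nonneg that by simp
    ultimately show ?thesis by (cases "TV h a t") auto
  qed
  have low: "\<bar>h t' - h t\<bar> \<le> real_of_ereal (TV h a t') - real_of_ereal (TV h a t)"
    if "a \<le> t" "t \<le> t'" "t' \<le> x" for t t'
    using TV_superadditive[OF that(1,2), of h] fin[of t] fin[of t'] that by auto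
  have "\<bar>h t' - h t\<bar> \<le> V t' - V t" if "a \<le> t" "t \<le> t'" "t' \<le> y" for t t'
    using low[of t t'] low[of t x] v[of x t'] v[of t t'] that unfolding V_def by auto
  then have "TV h a y \<le> ereal (V y - V a)"
    using assms by (intro TV_le_dominating) auto
  also have "V y - V a \<le> B + (v y - v x)"
  proof -
    have "0 \<le> V a" using TV_nonneg[of a a h] fin[of a] assms(2) by (auto simp: V_def)
    moreover have "real_of_ereal (TV h a x) \<le> B"
      using fin[of x] assms(1,2) by auto
    ultimately show ?thesis using assms(3) by (auto simp: V_def)
  qed
  finally show ?thesis by simp
qed

section \<open>The variation of a function of finite variation as a real function\<close>

lemma TV_finite:
  assumes "TV g a b < \<infinity>" "a \<le> s" "s \<le> b"
  shows "TV g a s = ereal (real_of_ereal (TV g a s))"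
  using TV_superadditive[of a s b g] TV_nonneg[of a s g] assms by (cases "TV g a s") auto

lemma TV_increment:
  assumes "TV g a b < \<infinity>" "a \<le> u" "u \<le> s" "s \<le> b"
  shows "\<bar>g s - g u\<bar> \<le> real_of_ereal (TV g a s) - real_of_ereal (TV g a u)"
proof -
  have "TV g a u + ereal \<bar>g s - g u\<bar> \<le> TV g a s"
    using assms by (intro TV_superadditive) auto
  moreover obtain r where "TV g a s = ereal r" using TV_finite[of g a b s] assms by auto
  moreover obtain q where "TV g a u = ereal q" using TV_finite[of g a b u] assms by auto
  ultimately show ?thesis by simp
qed

section \<open>Propagation of the comparison along a monotone phase\<close>

text \<open>Here \<open>w\<close> plays the variation of \<open>g\<close>, and \<open>h\<close>
  starts at the lower edge of the tube, hence below \<open>g\<close>. If \<open>g\<close> ends above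
  \<open>h\<close>, its net rise pays for everything. If it ends below, it was earlier forced up to
  nearly \<open>h s\<close> where \<open>f\<close> was near its supremum, and the way back pays for
  the gap.\<close>

lemma up_phase_interior:
  assumes w: "\<And>u t. a \<le> u \<Longrightarrow> u \<le> t \<Longrightarrow> t \<le> s \<Longrightarrow> \<bar>g t - g u\<bar> \<le> w t - w u"
    and near: "\<And>t. t \<in> {x..s} \<Longrightarrow> g t \<in> {f t - c / 2..f t + c / 2}"
    and bdd: "bdd_above (f ` {x..s})"
    and h: "\<And>t. t \<in> {x..s} \<Longrightarrow> h t = (SUP r\<in>{x..t}. f r) - c / 2"
    and le: "a \<le> x" "x \<le> s"
    and start: "TV h a x \<le> ereal (w x - \<bar>g x - h x\<bar>)"
  shows "TV h a s \<le> ereal (w s - \<bar>g s - h s\<bar>)"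
proof -
  have bdd': "bdd_above (f ` {x..t})" if "t \<le> s" for t
    using bdd by (rule bdd_above_mono) (use that in auto)
  have mono: "h t \<le> h t'" if "x \<le> t" "t \<le> t'" "t' \<le> s" for t t'
  proof -
    have "(SUP r\<in>{x..t}. f r) \<le> (SUP r\<in>{x..t'}. f r)"
      using that bdd' by (intro cSUP_subset_mono) auto
    then show ?thesis using h that by auto
  qed
  have hx: "h x \<le> g x" using h[of x] near[of x] le by auto
  have 1: "TV h a s \<le> ereal (w x - \<bar>g x - h x\<bar> + (h s - h x))"
    by (rule TV_extend_le[OF start]) (use le mono in \<open>auto simp: abs_if\<close>)
  have 2: "w x + \<bar>g u - g x\<bar> + \<bar>g s - g u\<bar> \<le> w s" if "u \<in> {x..s}" for u
    using w[of x u] w[of u s] that le by auto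
  have "w x - \<bar>g x - h x\<bar> + (h s - h x) \<le> w s - \<bar>g s - h s\<bar>"
  proof (cases "h s \<le> g s")
    case True
    then show ?thesis using 2[of s] le hx by auto
  next
    case False
    show ?thesis
    proof (rule field_le_epsilon)
      \<comment> \<open>The value \<open>g u\<close> enters twice, in the climb to \<open>u\<close>
        and in the descent to \<open>s\<close>, so \<open>f u\<close> is taken within
        \<open>e / 2\<close> of the supremum.\<close>
      fix e :: real assume "e > 0"
      then have "(SUP r\<in>{x..s}. f r) - e / 2 < (SUP r\<in>{x..s}. f r)" by simp
      then obtain u where u: "u \<in> {x..s}" "(SUP r\<in>{x..s}. f r) - e / 2 < f u"
        using less_cSUP_iff[OF _ bdd, of "(SUP r\<in>{x..s}. f r) - e / 2"] le by auto
      have "h s - e / 2 \<le> g u" using u near[of u] h[of s] le by auto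
      then show "w x - \<bar>g x - h x\<bar> + (h s - h x) \<le> w s - \<bar>g s - h s\<bar> + e"
        using 2[OF u(1)] hx False by linarith
    qed
  qed
  then show ?thesis using 1 order_trans by (metis ereal_less_eq(3))
qed

text \<open>At \<open>y\<close> the function \<open>h\<close> switches from the lower to the upper
  edge of the tube. The drop by \<open>c\<close> makes this a downward jump, so \<open>h\<close>
  climbs to at most \<open>S - c / 2\<close> and then falls to \<open>h y\<close>; \<open>g\<close>
  must climb almost as high and ends at or below \<open>h y\<close>.\<close>

lemma up_phase_end:
  assumes w: "\<And>u t. a \<le> u \<Longrightarrow> u \<le> t \<Longrightarrow> t \<le> y \<Longrightarrow> \<bar>g t - g u\<bar> \<le> w t - w u"
    and near: "\<And>t. t \<in> {x..y} \<Longrightarrow> g t \<in> {f t - c / 2..f t + c / 2}"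
    and bdd: "bdd_above (f ` {x..y})"
    and h: "\<And>t. t \<in> {x..<y} \<Longrightarrow> h t = (SUP r\<in>{x..t}. f r) - c / 2"
    and hy: "h y = f y + c / 2"
    and drop: "(SUP r\<in>{x..y}. f r) - f y \<ge> c" "c > 0"
    and le: "a \<le> x" "x < y"
    and start: "TV h a x \<le> ereal (w x - \<bar>g x - h x\<bar>)"
  shows "TV h a y \<le> ereal (w y - \<bar>g y - h y\<bar>)"
proof -
  have bdd': "bdd_above (f ` {x..t})" if "t \<le> y" for t
    using bdd by (rule bdd_above_mono) (use that in auto)
  have bdd'': "bdd_above (f ` {x..<y})"
    using bdd by (rule bdd_above_mono) auto
  define S where "S = (SUP r\<in>{x..<y}. f r)"
  have S: "f t \<le> S" if "t \<in> {x..<y}" for t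
    unfolding S_def using that bdd'' by (intro cSUP_upper)
  \<comment> \<open>The supremum over [x;y] cannot be \<open>f y\<close>, for then the drop would be
    0 < \<open>c\<close>; hence removing \<open>y\<close> preserves the bound.\<close>
  have Sy: "f y + c \<le> S"
  proof -
    have "(SUP r\<in>{x..y}. f r) \<le> max S (f y)"
    proof (rule cSUP_least)
      fix t assume "t \<in> {x..y}"
      then show "f t \<le> max S (f y)" using S[of t] by (cases "t = y") auto
    qed (use le in auto)
    then show ?thesis using drop by (auto simp: max_def split: if_splits)
  qed
  have mono: "h t \<le> h t'" if "x \<le> t" "t \<le> t'" "t' < y" for t t'
  proof -
    have "(SUP r\<in>{x..t}. f r) \<le> (SUP r\<in>{x..t'}. f r)"
      using that bdd' by (intro cSUP_subset_mono) auto
    then show ?thesis using h that by auto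
  qed
  have hS: "h t \<le> S - c / 2" if "t \<in> {x..<y}" for t
  proof -
    have "(SUP r\<in>{x..t}. f r) \<le> S" by (rule cSUP_least) (use that S in auto)
    then show ?thesis using h that by auto
  qed
  have hx: "h x \<le> g x" using h[of x] near[of x] le by auto
  have gy: "g y \<le> h y" using near[of y] hy le by auto
  \<comment> \<open>The end value is \<open>h y\<close> reflected at the level
    \<open>S - c / 2\<close>, so that the last increment of \<open>v\<close> counts a climb to this
    level plus a fall to \<open>h y\<close>.\<close>
  define v where "v t = (if t < y then h t else 2 * (S - c / 2) - h y)" for t
  have "TV h a y \<le> ereal (w x - \<bar>g x - h x\<bar> + (v y - v x))"
  proof (rule TV_extend_le[OF start])
    fix t t' assume t: "x \<le> t" "t \<le> t'" "t' \<le> y"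
    show "\<bar>h t' - h t\<bar> \<le> v t' - v t"
    proof (cases "t' < y")
      case True
      then show ?thesis using mono[of t t'] t by (simp add: v_def)
    next
      case False
      then have [simp]: "t' = y" using t by simp
      show ?thesis
      proof (cases "t < y")
        case True
        then show ?thesis using hS[of t] Sy hy t by (simp add: v_def abs_le_iff)
      next
        case False
        then have "t = y" using t by simp
        then show ?thesis by simp
      qed
    qed
  qed (use le in auto)
  also have "w x - \<bar>g x - h x\<bar> + (v y - v x) \<le> w y - \<bar>g y - h y\<bar>"
  proof (rule field_le_epsilon)
    fix e :: real assume "e > 0"
    then obtain u where u: "u \<in> {x..<y}" "S - e / 2 < f u"
      using less_cSUP_iff[OF _ bdd'', of "S - e / 2"] le by (auto simp: S_def)
    have "S - c / 2 - e / 2 \<le> g u" using u near[of u] by auto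
    moreover have "w x + \<bar>g u - g x\<bar> + \<bar>g y - g u\<bar> \<le> w y"
      using w[of x u] w[of u y] u le by auto
    ultimately show "w x - \<bar>g x - h x\<bar> + (v y - v x) \<le> w y - \<bar>g y - h y\<bar> + e"
      using hx gy le by (simp add: v_def)
  qed
  finally show ?thesis by simp
qed

section \<open>Decreasing phases by reflection\<close>

lemma INF_real_eq_uminus_SUP: "(INF t\<in>A. f t :: real) = - (SUP t\<in>A. - f t)"
  by (simp add: Inf_real_def image_image)

lemma bdd_above_uminus_image:
  "bdd_above ((\<lambda>t. - f t :: real) ` A) \<longleftrightarrow> bdd_below (f ` A)"
proof -
  have "(\<lambda>t. - f t) ` A = uminus ` f ` A" by (simp only: image_image)
  then show ?thesis by (simp only: bdd_above_uminus)
qed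

text \<open>Replacing \<open>f\<close>, \<open>g\<close>, \<open>h\<close> by their negatives turns
  this into an increasing phase and changes neither variations nor the gap between \<open>g\<close>
  and \<open>h\<close>; the same \<open>w\<close> serves.\<close>

lemma down_phase_interior:
  assumes w: "\<And>u t. a \<le> u \<Longrightarrow> u \<le> t \<Longrightarrow> t \<le> s \<Longrightarrow> \<bar>g t - g u\<bar> \<le> w t - w u"
    and near: "\<And>t. t \<in> {x..s} \<Longrightarrow> g t \<in> {f t - c / 2..f t + c / 2}"
    and bdd: "bdd_below (f ` {x..s})"
    and h: "\<And>t. t \<in> {x..s} \<Longrightarrow> h t = (INF r\<in>{x..t}. f r) + c / 2"
    and le: "a \<le> x" "x \<le> s"
    and start: "TV h a x \<le> ereal (w x - \<bar>g x - h x\<bar>)"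
  shows "TV h a s \<le> ereal (w s - \<bar>g s - h s\<bar>)"
proof -
  have "TV (\<lambda>t. - h t) a s \<le> ereal (w s - \<bar>- g s - - h s\<bar>)"
  proof (rule up_phase_interior[where f = "\<lambda>t. - f t" and x = x and c = c])
    show "bdd_above ((\<lambda>t. - f t) ` {x..s})"
      using bdd by (simp only: bdd_above_uminus_image)
    show "- g t \<in> {- f t - c / 2..- f t + c / 2}" if "t \<in> {x..s}" for t
      using near[OF that] by auto
    show "TV (\<lambda>t. - h t) a x \<le> ereal (w x - \<bar>- g x - - h x\<bar>)"
      using start by (simp add: TV_uminus abs_minus_commute)
  qed (use w h le in
      \<open>simp_all add: TV_uminus INF_real_eq_uminus_SUP abs_minus_commute\<close>)
  then show ?thesis by (simp add: TV_uminus abs_minus_commute)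
qed

lemma down_phase_end:
  assumes w: "\<And>u t. a \<le> u \<Longrightarrow> u \<le> t \<Longrightarrow> t \<le> y \<Longrightarrow> \<bar>g t - g u\<bar> \<le> w t - w u"
    and near: "\<And>t. t \<in> {x..y} \<Longrightarrow> g t \<in> {f t - c / 2..f t + c / 2}"
    and bdd: "bdd_below (f ` {x..y})"
    and h: "\<And>t. t \<in> {x..<y} \<Longrightarrow> h t = (INF r\<in>{x..t}. f r) + c / 2"
    and hy: "h y = f y - c / 2"
    and rise: "f y - (INF r\<in>{x..y}. f r) \<ge> c" "c > 0"
    and le: "a \<le> x" "x < y"
    and start: "TV h a x \<le> ereal (w x - \<bar>g x - h x\<bar>)"
  shows "TV h a y \<le> ereal (w y - \<bar>g y - h y\<bar>)"
proof -
  have "TV (\<lambda>t. - h t) a y \<le> ereal (w y - \<bar>- g y - - h y\<bar>)"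
  proof (rule up_phase_end[where f = "\<lambda>t. - f t" and x = x and c = c])
    show "bdd_above ((\<lambda>t. - f t) ` {x..y})"
      using bdd by (simp only: bdd_above_uminus_image)
    show "- g t \<in> {- f t - c / 2..- f t + c / 2}" if "t \<in> {x..y}" for t
      using near[OF that] by auto
    show "TV (\<lambda>t. - h t) a x \<le> ereal (w x - \<bar>- g x - - h x\<bar>)"
      using start by (simp add: TV_uminus abs_minus_commute)
  qed (use w h hy rise le in
      \<open>simp_all add: TV_uminus INF_real_eq_uminus_SUP abs_minus_commute\<close>)
  then show ?thesis by (simp add: TV_uminus abs_minus_commute)
qed

section \<open>The stopping times\<close>

text \<open>The infimum of reals is defined by negating a supremum, so the reflection is exact for
  every \<open>f\<close>, bounded or not.\<close>

lemma drawup_time_eq_drawdown: "drawup_time f b c x = drawdown_time (\<lambda>t. - f t) b c x"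
  unfolding drawup_time_def drawdown_time_def INF_real_eq_uminus_SUP
  by (simp add: add.commute)

lemma atLeastAtMost_ereal_real: "{t. ereal x \<le> ereal t \<and> t \<le> s} = {x..s}"
  by auto

text \<open>Right-continuity makes the infimum defining the drawdown time a minimum.\<close>
lemma drawdown_time_attained:
  assumes fin: "drawdown_time f b c (ereal x) < \<infinity>"
    and rc: "\<And>t. t \<in> {x..<b} \<Longrightarrow> (f \<longlongrightarrow> f t) (at_right t)"
    and bdd: "bdd_above (f ` {x..b})" and c: "c > 0"
  obtains y where "drawdown_time f b c (ereal x) = ereal y" "x < y" "y \<le> b"
    "(SUP t\<in>{x..y}. f t) - f y \<ge> c"
proof -
  define A where "A = {s. x \<le> s \<and> s \<le> b \<and> (SUP t\<in>{x..s}. f t) - f s \<ge> c}"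
  have dA: "drawdown_time f b c (ereal x) = Inf (ereal ` A)"
    unfolding drawdown_time_def A_def atLeastAtMost_ereal_real by simp
  \<comment> \<open>The infimum of the empty set in \<open>ereal\<close> is infinity, which
    \<open>fin\<close> excludes.\<close>
  have ne: "A \<noteq> {}" using fin dA by (auto simp: top_ereal_def)
  have bA: "bdd_below A" unfolding A_def by (rule bdd_belowI[of _ x]) auto
  define y where "y = Inf A"
  have xy: "x \<le> y" unfolding y_def using ne by (intro cInf_greatest) (auto simp: A_def)
  have yle: "y \<le> s" if "s \<in> A" for s unfolding y_def using that bA by (rule cInf_lower)
  have yb: "y \<le> b" using ne yle by (force simp: A_def)
  have "y \<in> A"
  proof (rule ccontr)
    assume nA: "y \<notin> A"
    then have lt: "(SUP t\<in>{x..y}. f t) - f y < c" using xy yb by (auto simp: A_def)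
    have "y < b"
    proof (rule ccontr)
      assume "\<not> y < b"
      then have "y = b" using yb by simp
      moreover obtain s where "s \<in> A" using ne by auto
      ultimately show False using yle[of s] nA by (auto simp: A_def)
    qed
    \<comment> \<open>While \<open>f\<close> stays within \<open>e\<close> of \<open>f y\<close> to
      the right of \<open>y\<close>, the drop is below the old drop plus \<open>e\<close> or below
      \<open>2 * e\<close>. Both are at most \<open>c\<close>, so no point of \<open>A\<close> lies
      just after \<open>y\<close>.\<close>
    define e where "e = min c (c - ((SUP t\<in>{x..y}. f t) - f y)) / 2"
    have e: "e > 0" "2 * e \<le> c" "2 * e \<le> c - ((SUP t\<in>{x..y}. f t) - f y)"
      using c lt by (auto simp: e_def)
    have "\<forall>\<^sub>F t in at_right y. dist (f t) (f y) < e"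
      using rc[of y] xy \<open>y < b\<close> e(1) by (auto dest: tendstoD)
    then obtain z where z: "z > y" "\<And>t. y < t \<Longrightarrow> t < z \<Longrightarrow> dist (f t) (f y) < e"
      unfolding eventually_at_right_field by blast
    obtain s where s: "s \<in> A" "s < z"
      using cInf_less_iff[OF ne bA, of z] z(1) by (auto simp: y_def)
    have cl: "\<bar>f t - f y\<bar> < e" if "y \<le> t" "t \<le> s" for t
      using z(2)[of t] that s(2) e(1) by (cases "t = y") (auto simp: dist_real_def)
    have "(SUP t\<in>{x..s}. f t) \<le> max (SUP t\<in>{x..y}. f t) (f y + e)"
    proof (rule cSUP_least)
      fix t assume t: "t \<in> {x..s}"
      show "f t \<le> max (SUP t\<in>{x..y}. f t) (f y + e)"
      proof (cases "t \<le> y")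
        case True
        have "bdd_above (f ` {x..y})" using bdd by (rule bdd_above_mono) (use yb in auto)
        then have "f t \<le> (SUP t\<in>{x..y}. f t)" using t True by (intro cSUP_upper) auto
        then show ?thesis by simp
      next
        case False
        then show ?thesis using cl[of t] t by auto
      qed
    qed (use s in \<open>auto simp: A_def\<close>)
    moreover have "f y - e < f s" using cl[of s] yle[OF s(1)] by auto
    moreover have "c \<le> (SUP t\<in>{x..s}. f t) - f s" using s(1) by (auto simp: A_def)
    ultimately show False using e by (auto simp: max_def split: if_splits)
  qed
  \<comment> \<open>The drop at the starting point is 0; this makes the stopping time strictly later
    than \<open>x\<close>.\<close>
  moreover have "x \<notin> A" using c by (auto simp: A_def)
  moreover have "Inf (ereal ` A) = ereal y"
  proof (rule Inf_eqI)
    show "ereal y \<le> i" if "i \<in> ereal ` A" for i using that yle by auto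
    show "z \<le> ereal y" if "\<And>i. i \<in> ereal ` A \<Longrightarrow> z \<le> i" for z using that \<open>y \<in> A\<close> by auto
  qed
  ultimately show ?thesis using that[of y] dA xy by (force simp: A_def)
qed

lemma drawup_time_attained:
  assumes fin: "drawup_time f b c (ereal x) < \<infinity>"
    and rc: "\<And>t. t \<in> {x..<b} \<Longrightarrow> (f \<longlongrightarrow> f t) (at_right t)"
    and bdd: "bdd_below (f ` {x..b})" and c: "c > 0"
  obtains y where "drawup_time f b c (ereal x) = ereal y" "x < y" "y \<le> b"
    "f y - (INF t\<in>{x..y}. f t) \<ge> c"
proof -
  have "bdd_above ((\<lambda>t. - f t) ` {x..b})"
    using bdd by (simp only: bdd_above_uminus_image)
  then obtain y where "drawdown_time (\<lambda>t. - f t) b c (ereal x) = ereal y" "x < y" "y \<le> b"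
    "(SUP t\<in>{x..y}. - f t) - (- f y) \<ge> c"
    using drawdown_time_attained[of "\<lambda>t. - f t" b c x] fin rc c
    unfolding drawup_time_eq_drawdown by (auto intro: tendsto_minus)
  then show ?thesis using that[of y] by (simp add: drawup_time_eq_drawdown INF_real_eq_uminus_SUP)
qed

section \<open>Interlacing of the stopping times and disjointness of the phases\<close>

lemma le_next_TD: "x \<le> next_TD f b c x"
  unfolding next_TD_def drawdown_time_def by (auto intro!: Inf_greatest)

lemma le_next_TU: "x \<le> next_TU f b c x"
  unfolding next_TU_def drawup_time_def by (auto intro!: Inf_greatest)

lemma TU_Suc_eq: "TU f a b c (Suc k) = next_TU f b c (TD f a b c k)"
  by (simp add: TD_def)

lemma TU_le_TD: "TU f a b c k \<le> TD f a b c k"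
  by (simp add: TD_def le_next_TD)

lemma TD_le_TU_Suc: "TD f a b c k \<le> TU f a b c (Suc k)"
  unfolding TU_Suc_eq by (rule le_next_TU)

lemma TU_mono: "j \<le> k \<Longrightarrow> TU f a b c j \<le> TU f a b c k"
  by (rule lift_Suc_mono_le) (use TU_le_TD TD_le_TU_Suc order_trans in blast)

lemma TD_le_TU: "j < k \<Longrightarrow> TD f a b c j \<le> TU f a b c k"
  using TD_le_TU_Suc[of f a b c j] TU_mono[of "Suc j" k f a b c] by (simp add: Suc_le_eq del: TU.simps)

lemma TD_mono: "j \<le> k \<Longrightarrow> TD f a b c j \<le> TD f a b c k"
  using TD_le_TU[of j k f a b c] TU_le_TD[of f a b c k] by (cases "j = k") auto

text \<open>A later upper phase starts no earlier than the end of any previous one. This gives the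
  \<open>THE\<close> in \<open>fc_up_first\<close> its meaning.\<close>

lemma in_upper_unique: "in_upper f a b c s k \<Longrightarrow> in_upper f a b c s j \<Longrightarrow> j = k"
  unfolding in_upper_def
  using TD_le_TU[of j k f a b c] TD_le_TU[of k j f a b c]
  by (metis leD linorder_neqE_nat order_less_le_trans)

lemma in_lower_unique: "in_lower f a b c s k \<Longrightarrow> in_lower f a b c s j \<Longrightarrow> j = k"
  unfolding in_lower_def
  using TU_mono[of "Suc j" k f a b c] TU_le_TD[of f a b c k]
    TU_mono[of "Suc k" j f a b c] TU_le_TD[of f a b c j]
  by (metis Suc_leI leD linorder_neqE_nat order_less_le_trans)

text \<open>\<open>fc_up_first\<close> looks for an upper phase first, so a point of a lower phase
  reaches the last branch only by this exclusion.\<close>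

lemma not_in_lower_in_upper: "in_lower f a b c s k \<Longrightarrow> \<not> in_upper f a b c s j"
  unfolding in_lower_def in_upper_def
  using TU_mono[of "Suc k" j f a b c] TD_mono[of j k f a b c]
  by (metis leD not_less_eq_eq order_less_le_trans)

lemma fc_up_first_upper:
  assumes "in_upper f a b c s k"
  shows "fc_up_first f a b c s = M_run f a b c k s - c / 2"
proof -
  have "(THE k. in_upper f a b c s k) = k"
    using assms in_upper_unique by (intro the_equality) blast+
  moreover have "\<not> ereal s < TU f a b c 0"
    using assms TU_mono[of 0 k f a b c] unfolding in_upper_def by auto
  ultimately show ?thesis unfolding fc_up_first_def using assms by auto
qed

lemma fc_up_first_lower:
  assumes "in_lower f a b c s k"
  shows "fc_up_first f a b c s = m_Suc f a b c k s + c / 2"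
proof -
  have "(THE k. in_lower f a b c s k) = k"
    using assms in_lower_unique by (intro the_equality) blast+
  moreover have "\<not> ereal s < TU f a b c 0"
    using assms TU_mono[of 0 k f a b c] TU_le_TD[of f a b c k] unfolding in_lower_def by auto
  ultimately show ?thesis unfolding fc_up_first_def using assms not_in_lower_in_upper by auto
qed

section \<open>Optimality and uniqueness when the first phase is increasing\<close>

text \<open>The results concern \<open>fc_up_first\<close> alone, so that the locale can be
  instantiated with \<open>f\<close>, \<open>g\<close> or with their negatives, according to the
  case in \<open>fc\<close>.\<close>

locale bv_in_tube =
  fixes f g :: "real \<Rightarrow> real" and a b c :: real
  assumes ab: "a < b" and cadlag: "cadlag_on a b f" and c_pos: "c > 0"
    and near: "\<And>t. t \<in> {a..b} \<Longrightarrow> g t \<in> {f t - c / 2..f t + c / 2}"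
    and TV_fin: "TV g a b < \<infinity>"
begin

definition w where "w s = real_of_ereal (TV g a s)"

abbreviation h where "h \<equiv> fc_up_first f a b c"

text \<open>The invariant carried from one stopping time to the next. Dropping the gap gives
  optimality; equal variations force the gap to vanish.\<close>

definition dominated where "dominated s \<longleftrightarrow> TV h a s \<le> ereal (w s - \<bar>g s - h s\<bar>)"

lemma w_increment: "a \<le> u \<Longrightarrow> u \<le> t \<Longrightarrow> t \<le> b \<Longrightarrow> \<bar>g t - g u\<bar> \<le> w t - w u"
  unfolding w_def using TV_increment[OF TV_fin] .

lemma w_nonneg: "a \<le> u \<Longrightarrow> 0 \<le> w u"
  unfolding w_def using TV_nonneg real_of_ereal_pos by blast

text \<open>Boundedness of \<open>f\<close> is read off \<open>g\<close>: finite variation bounds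
  \<open>g\<close>, and \<open>f\<close> stays within \<open>c / 2\<close> of it.\<close>

lemma f_bound:
  assumes "t \<in> {a..b}" shows "\<bar>f t\<bar> \<le> \<bar>g a\<bar> + w b + c / 2"
proof -
  have "\<bar>g t - g a\<bar> \<le> w t - w a" "\<bar>g b - g t\<bar> \<le> w b - w t"
    using assms by (auto intro: w_increment)
  then show ?thesis using near[OF assms] w_nonneg[of a] by auto
qed

lemma bdd_above_f: "a \<le> x \<Longrightarrow> y \<le> b \<Longrightarrow> bdd_above (f ` {x..y})"
  using f_bound by (intro bdd_aboveI2[of _ _ "\<bar>g a\<bar> + w b + c / 2"]) (force simp: abs_le_iff)

lemma bdd_below_f: "a \<le> x \<Longrightarrow> y \<le> b \<Longrightarrow> bdd_below (f ` {x..y})"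
proof (rule bdd_belowI2[of _ "- (\<bar>g a\<bar> + w b + c / 2)"])
  fix t assume "a \<le> x" "y \<le> b" "t \<in> {x..y}"
  then show "- (\<bar>g a\<bar> + w b + c / 2) \<le> f t" using f_bound[of t] by auto
qed

lemma right_cont: "a \<le> t \<Longrightarrow> t < b \<Longrightarrow> (f \<longlongrightarrow> f t) (at_right t)"
  using cadlag unfolding cadlag_on_def by auto

lemma next_TD_attained:
  assumes "next_TD f b c (ereal x) < \<infinity>" "a \<le> x"
  obtains y where "next_TD f b c (ereal x) = ereal y" "x < y" "y \<le> b"
    "(SUP t\<in>{x..y}. f t) - f y \<ge> c"
  using assms drawdown_time_attained[of f b c x] right_cont bdd_above_f[of x b] c_pos
  unfolding next_TD_def by (auto split: if_splits)

lemma next_TU_attained: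
  assumes "next_TU f b c (ereal x) < \<infinity>" "a \<le> x"
  obtains y where "next_TU f b c (ereal x) = ereal y" "x < y" "y \<le> b"
    "f y - (INF t\<in>{x..y}. f t) \<ge> c"
  using assms drawup_time_attained[of f b c x] right_cont bdd_below_f[of x b] c_pos
  unfolding next_TU_def by (auto split: if_splits)

text \<open>Puts the first stopping time on the same footing as the later ones.\<close>

lemma TU_0_eq: "TU f a b c 0 = next_TU f b c (ereal a)"
  using ab by (simp add: T_U_def next_TU_def)

lemma TU_TD_real:
  shows TU_real: "TU f a b c k < \<infinity> \<Longrightarrow> \<exists>x. TU f a b c k = ereal x \<and> a < x \<and> x \<le> b"
    and TD_real: "TD f a b c k < \<infinity> \<Longrightarrow> \<exists>x. TD f a b c k = ereal x \<and> a < x \<and> x \<le> b"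
proof -
  have TD: "\<exists>x. TD f a b c k = ereal x \<and> a < x \<and> x \<le> b"
    if TU: "TU f a b c k < \<infinity> \<Longrightarrow> \<exists>x. TU f a b c k = ereal x \<and> a < x \<and> x \<le> b"
      and fin: "TD f a b c k < \<infinity>" for k
  proof -
    obtain x where x: "TU f a b c k = ereal x" "a < x" "x \<le> b"
      using TU TU_le_TD[of f a b c k] fin by (meson order_le_less_trans)
    then show ?thesis using next_TD_attained[of x] fin unfolding TD_def by force
  qed
  have TU: "TU f a b c k < \<infinity> \<Longrightarrow> \<exists>x. TU f a b c k = ereal x \<and> a < x \<and> x \<le> b" for k
  proof (induction k)
    case 0
    then show ?case using next_TU_attained[of a] unfolding TU_0_eq by auto
  next
    case (Suc k)
    then obtain x where x: "TD f a b c k = ereal x" "a < x" "x \<le> b"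
      using TD[of k] TD_le_TU_Suc[of f a b c k] by (meson order_le_less_trans)
    then show ?case using next_TU_attained[of x] Suc.prems unfolding TU_Suc_eq by force
  qed
  show "TU f a b c k < \<infinity> \<Longrightarrow> \<exists>x. TU f a b c k = ereal x \<and> a < x \<and> x \<le> b" by (rule TU)
  show "TD f a b c k < \<infinity> \<Longrightarrow> \<exists>x. TD f a b c k = ereal x \<and> a < x \<and> x \<le> b" by (rule TD[OF TU])
qed

text \<open>Infinitely many phases would accumulate at a point without a left limit.\<close>
lemma ex_phase:
  assumes "TU f a b c 0 \<le> ereal s" "s \<le> b"
  obtains k where "in_upper f a b c s k \<or> in_lower f a b c s k"
proof (rule ccontr)
  assume "\<not> thesis"
  then have no: "\<not> in_upper f a b c s k" "\<not> in_lower f a b c s k" for k using that by blast+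
  \<comment> \<open>A point in no phase has already passed each successive stopping time.\<close>
  have all: "TU f a b c k \<le> ereal s \<and> TD f a b c k \<le> ereal s" for k
  proof (induction k)
    case 0
    then show ?case using assms no(1)[of 0] by (auto simp: in_upper_def)
  next
    case (Suc k)
    then have "TU f a b c (Suc k) \<le> ereal s" using no(2)[of k] by (auto simp: in_lower_def)
    then show ?case using no(1)[of "Suc k"] by (auto simp: in_upper_def)
  qed
  have fin: "TU f a b c k < \<infinity>" "TD f a b c k < \<infinity>" for k
    using all[of k] by (auto intro: order_le_less_trans[of _ "ereal s"])
  have "\<forall>k. \<exists>x. TU f a b c k = ereal x \<and> a < x \<and> x \<le> b"
    using TU_real[OF fin(1)] by blast
  then obtain p where p: "\<And>k. TU f a b c k = ereal (p k)" "\<And>k. a < p k" "\<And>k. p k \<le> b" by metis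
  have "\<exists>y. TD f a b c k = ereal y \<and> p k < y \<and> y \<le> b \<and> (SUP t\<in>{p k..y}. f t) - f y \<ge> c" for k
  proof -
    have "next_TD f b c (ereal (p k)) < \<infinity>" using fin(2)[of k] unfolding TD_def p .
    from next_TD_attained[OF this] show ?thesis using p(2)[of k] unfolding TD_def p by auto
  qed
  then obtain q where q: "\<And>k. TD f a b c k = ereal (q k)" "\<And>k. p k < q k"
    "\<And>k. (SUP t\<in>{p k..q k}. f t) - f (q k) \<ge> c" by metis
  have qp: "q k \<le> p (Suc k)" for k
    using TD_le_TU_Suc[of f a b c k] unfolding p q by simp
  have pp: "p k < p (Suc k)" for k using q(2)[of k] qp[of k] by simp
  have inc: "incseq p" using pp less_imp_le by (auto intro!: incseq_SucI)
  have bp: "bdd_above (range p)" using p(3) by (auto intro!: bdd_aboveI2)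
  define L where "L = (SUP k. p k)"
  have lim: "p \<longlonglongrightarrow> L" unfolding L_def using bp inc by (rule LIMSEQ_incseq_SUP)
  have pL: "p k < L" for k
    using pp[of k] cSUP_upper[OF UNIV_I bp, of "Suc k"] unfolding L_def by simp
  have "L \<le> b" unfolding L_def using p(3) by (intro cSUP_least) auto
  moreover have "a < L" using p(2)[of 0] pL[of 0] by simp
  ultimately obtain l where "(f \<longlongrightarrow> l) (at_left L)"
    using cadlag unfolding cadlag_on_def by (meson greaterThanAtMost_iff)
  then have "\<forall>\<^sub>F t in at_left L. dist (f t) l < c / 4"
    using c_pos by (intro tendstoD) auto
  then obtain z where z: "z < L" "\<And>t. z < t \<Longrightarrow> t < L \<Longrightarrow> dist (f t) l < c / 4"
    unfolding eventually_at_left_field by blast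
  obtain k where k: "z < p k"
    using order_tendstoD(1)[OF lim z(1)] by (metis eventually_happens' sequentially_bot)
  \<comment> \<open>The whole phase lies in the left neighbourhood of \<open>L\<close> where
    \<open>f\<close> is within \<open>c / 4\<close> of \<open>l\<close>. Its drop is then below
    \<open>c / 2\<close>, although it ends with a drop of at least \<open>c\<close>.\<close>
  have cl: "\<bar>f t - l\<bar> < c / 4" if "t \<in> {p k..q k}" for t
    using z(2)[of t] k that qp[of k] pL[of "Suc k"] by (auto simp: dist_real_def)
  have "(SUP t\<in>{p k..q k}. f t) \<le> l + c / 4"
  proof (rule cSUP_least)
    show "f t \<le> l + c / 4" if "t \<in> {p k..q k}" for t using cl[OF that] by linarith
  qed (use q(2)[of k] in auto)
  then show False using q(3)[of k] cl[of "q k"] q(2)[of k] c_pos by (auto simp: abs_less_iff)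
qed

section \<open>Values of f^c on the phases and at the stopping times\<close>

lemma fc_upper_eq:
  assumes "TU f a b c k = ereal x" "x \<le> t" "ereal t < TD f a b c k"
  shows "h t = (SUP r\<in>{x..t}. f r) - c / 2"
  using assms(2,3) fc_up_first_upper[of f a b c t k]
  unfolding in_upper_def M_run_def assms(1) atLeastAtMost_ereal_real by simp

lemma fc_lower_eq:
  assumes "TD f a b c k = ereal x" "x \<le> t" "ereal t < TU f a b c (Suc k)"
  shows "h t = (INF r\<in>{x..t}. f r) + c / 2"
  using assms(2,3) fc_up_first_lower[of f a b c t k]
  unfolding in_lower_def m_Suc_def assms(1) atLeastAtMost_ereal_real by (simp del: TU.simps)

text \<open>The next stopping time is strictly later, so \<open>x\<close> belongs to the phase it
  opens, and the running supremum there is over the single point \<open>x\<close>.\<close>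

lemma fc_at_TU:
  assumes "TU f a b c k = ereal x"
  shows "h x = f x - c / 2"
proof -
  have "a < x" using TU_real[of k] assms by auto
  have "ereal x < TD f a b c k"
  proof (cases "TD f a b c k < \<infinity>")
    case True
    then show ?thesis using next_TD_attained[of x] \<open>a < x\<close> assms unfolding TD_def by force
  qed (simp add: top.not_eq_extremum)
  then show ?thesis using fc_upper_eq[OF assms, of x] by simp
qed

lemma fc_at_TD:
  assumes "TD f a b c k = ereal x"
  shows "h x = f x + c / 2"
proof -
  have "a < x" using TD_real[of k] assms by auto
  have "ereal x < TU f a b c (Suc k)"
  proof (cases "TU f a b c (Suc k) < \<infinity>")
    case True
    then show ?thesis using next_TU_attained[of x] \<open>a < x\<close> assms unfolding TU_Suc_eq by force
  qed (simp add: top.not_eq_extremum)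
  then show ?thesis using fc_lower_eq[OF assms, of x] by simp
qed

lemma fc_initial:
  assumes "a \<le> t" "ereal t < TU f a b c 0"
  shows "h t = m_zero f a b c + c / 2"
  unfolding fc_up_first_def using assms by simp

section \<open>The initial interval and the first jump\<close>

lemma TV_fc_initial:
  assumes "a \<le> s" "ereal s < TU f a b c 0"
  shows "TV h a s = 0"
proof -
  have "h t = m_zero f a b c + c / 2" if "a \<le> t" "t \<le> s" for t
    using fc_initial that assms(2) by (meson ereal_less_eq(3) order_le_less_trans)
  then have "TV h a s \<le> ereal (0 - 0)"
    by (intro TV_le_dominating[where v = "\<lambda>_. 0"]) (use assms in auto)
  then show ?thesis using TV_nonneg[OF assms(1), of h] by (simp add: zero_ereal_def)
qed

lemma m_zero_le: "t \<in> {a..b} \<Longrightarrow> ereal t < TU f a b c 0 \<Longrightarrow> m_zero f a b c \<le> f t"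
  unfolding m_zero_def
  by (intro cINF_lower bdd_below_mono[OF bdd_below_f[of a b]]) auto

lemma m_zero_approx:
  assumes "e > 0"
  obtains t where "t \<in> {a..b}" "ereal t < TU f a b c 0" "f t < m_zero f a b c + e"
proof -
  let ?A = "{t \<in> {a..b}. ereal t < TU f a b c 0}"
  have "ereal a < TU f a b c 0"
    by (cases "TU f a b c 0 < \<infinity>") (use TU_real[of 0] in \<open>auto simp: top.not_eq_extremum simp del: TU.simps\<close>)
  then have "?A \<noteq> {}" using ab by (auto intro!: exI[of _ a])
  moreover have "bdd_below (f ` ?A)" by (rule bdd_below_mono[OF bdd_below_f[of a b]]) auto
  ultimately show ?thesis
    using cINF_less_iff[of ?A f "m_zero f a b c + e"] assms that unfolding m_zero_def by auto
qed

text \<open>The rise is measured from the infimum over the closed interval up to \<open>x\<close>,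
  \<open>m_zero\<close> is taken over the half-open one. They can differ only if \<open>f x\<close>
  is the infimum, but then the rise would be 0.\<close>

lemma rise_at_TU_0:
  assumes "TU f a b c 0 = ereal x"
  shows "m_zero f a b c + c \<le> f x"
proof -
  obtain y where y: "next_TU f b c (ereal a) = ereal y" "a < y" "y \<le> b"
    "f y - (INF t\<in>{a..y}. f t) \<ge> c"
    using next_TU_attained[of a] assms unfolding TU_0_eq by auto
  have xy: "x = y" using y(1) assms TU_0_eq by simp
  have "min (m_zero f a b c) (f y) \<le> (INF t\<in>{a..y}. f t)"
  proof (rule cINF_greatest)
    show "min (m_zero f a b c) (f y) \<le> f t" if "t \<in> {a..y}" for t
      using m_zero_le[of t] assms xy that y(3) by (cases "t = y") auto
  qed (use y in auto)
  then show ?thesis using y(4) c_pos xy by (auto simp: min_def split: if_splits)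
qed

text \<open>f^c is constant before \<open>x\<close> and jumps upwards at \<open>x\<close>, hence is
  monotone and dominates its own increments.\<close>

lemma TV_fc_TU_0_le:
  assumes "TU f a b c 0 = ereal x"
  shows "TV h a x \<le> ereal (h x - h a)"
proof (rule TV_le_dominating)
  have ini: "h t = m_zero f a b c + c / 2" if "a \<le> t" "t < x" for t
    using fc_initial[of t] assms that by simp
  have rise: "m_zero f a b c + c / 2 \<le> h x"
    using rise_at_TU_0[OF assms] fc_at_TU[OF assms] by simp
  fix t t' assume "a \<le> t" "t \<le> t'" "t' \<le> x"
  then show "\<bar>h t' - h t\<bar> \<le> h t' - h t"
    using ini[of t] ini[of t'] rise by (cases "t = x"; cases "t' = x") auto
next
  show "a \<le> x" using TU_real[of 0] assms by auto
qed

text \<open>Where \<open>f\<close> is near \<open>m_zero\<close>, \<open>g\<close> lies at most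
  slightly above \<open>h a\<close>; at \<open>x\<close> it lies above \<open>h x\<close>. Its rise
  in between covers both the jump of \<open>h\<close> and the gap at \<open>x\<close>.\<close>

lemma dominated_TU_0:
  assumes "TU f a b c 0 = ereal x"
  shows "dominated x"
proof -
  have x: "a < x" "x \<le> b" using TU_real[of 0] assms by auto
  have hx: "h x = f x - c / 2" using fc_at_TU[OF assms] .
  have "TV h a x \<le> ereal (h x - h a)" by (rule TV_fc_TU_0_le[OF assms])
  also have "h x - h a \<le> w x - \<bar>g x - h x\<bar>"
  proof (rule field_le_epsilon)
    fix e :: real assume "e > 0"
    then obtain u where u: "u \<in> {a..b}" "ereal u < TU f a b c 0" "f u < m_zero f a b c + e"
      by (rule m_zero_approx)
    have "u < x" using u(2) assms by simp
    have "g u \<le> m_zero f a b c + e + c / 2" using near[OF u(1)] u(3) by auto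
    moreover have "g x - g u \<le> w x"
      using w_increment[of u x] w_nonneg[of u] u \<open>u < x\<close> x by auto
    moreover have "h x \<le> g x" using hx near[of x] x by auto
    ultimately show "h x - h a \<le> w x - \<bar>g x - h x\<bar> + e"
      using fc_initial[of a] assms x by auto
  qed
  finally show ?thesis by (simp add: dominated_def)
qed

section \<open>Propagation of the invariant to all later times\<close>

lemma dominated_upper:
  assumes "TU f a b c k = ereal x" "dominated x" "in_upper f a b c s k" "s \<le> b"
  shows "dominated s"
  unfolding dominated_def
proof (rule up_phase_interior[where f = f and x = x and c = c])
  have x: "a < x" "x \<le> s" using assms TU_real[of k] by (auto simp: in_upper_def)
  show "\<And>t. t \<in> {x..s} \<Longrightarrow> h t = (SUP r\<in>{x..t}. f r) - c / 2"
    using fc_upper_eq[OF assms(1)] assms(3) unfolding in_upper_def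
    by (metis atLeastAtMost_iff ereal_less_eq(3) order_le_less_trans)
  show "TV h a x \<le> ereal (w x - \<bar>g x - h x\<bar>)" using assms(2) by (simp add: dominated_def)
  show "bdd_above (f ` {x..s})" using x assms by (intro bdd_above_f) auto
qed (use assms TU_real[of k] w_increment near in \<open>auto simp: in_upper_def\<close>)

lemma dominated_lower:
  assumes "TD f a b c k = ereal x" "dominated x" "in_lower f a b c s k" "s \<le> b"
  shows "dominated s"
  unfolding dominated_def
proof (rule down_phase_interior[where f = f and x = x and c = c])
  have x: "a < x" "x \<le> s" using assms TD_real[of k] by (auto simp: in_lower_def)
  show "\<And>t. t \<in> {x..s} \<Longrightarrow> h t = (INF r\<in>{x..t}. f r) + c / 2"
    using fc_lower_eq[OF assms(1)] assms(3) unfolding in_lower_def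
    by (metis atLeastAtMost_iff ereal_less_eq(3) order_le_less_trans)
  show "TV h a x \<le> ereal (w x - \<bar>g x - h x\<bar>)" using assms(2) by (simp add: dominated_def)
  show "bdd_below (f ` {x..s})" using x assms by (intro bdd_below_f) auto
qed (use assms TD_real[of k] w_increment near in \<open>auto simp: in_lower_def\<close>)

lemma dominated_TD:
  assumes "TU f a b c k = ereal x" "dominated x" "TD f a b c k = ereal y"
  shows "dominated y"
proof -
  have x: "a < x" using assms TU_real[of k] by auto
  obtain y: "x < y" "y \<le> b" "(SUP t\<in>{x..y}. f t) - f y \<ge> c"
    using next_TD_attained[of x] assms(1,3) x unfolding TD_def by auto
  show ?thesis
    unfolding dominated_def
  proof (rule up_phase_end[where f = f and x = x and c = c])
    show "\<And>t. t \<in> {x..<y} \<Longrightarrow> h t = (SUP r\<in>{x..t}. f r) - c / 2"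
      using fc_upper_eq[OF assms(1)] assms(3) by simp
    show "TV h a x \<le> ereal (w x - \<bar>g x - h x\<bar>)" using assms(2) by (simp add: dominated_def)
    show "bdd_above (f ` {x..y})" using x y by (intro bdd_above_f) auto
  qed (use x y w_increment near fc_at_TD[OF assms(3)] c_pos in auto)
qed

lemma dominated_TU_Suc:
  assumes "TD f a b c k = ereal x" "dominated x" "TU f a b c (Suc k) = ereal y"
  shows "dominated y"
proof -
  have x: "a < x" using assms TD_real[of k] by auto
  obtain y: "x < y" "y \<le> b" "f y - (INF t\<in>{x..y}. f t) \<ge> c"
    using next_TU_attained[of x] assms(1,3) x unfolding TU_Suc_eq by auto
  show ?thesis
    unfolding dominated_def
  proof (rule down_phase_end[where f = f and x = x and c = c])
    show "\<And>t. t \<in> {x..<y} \<Longrightarrow> h t = (INF r\<in>{x..t}. f r) + c / 2"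
      using fc_lower_eq[OF assms(1)] assms(3) by simp
    show "TV h a x \<le> ereal (w x - \<bar>g x - h x\<bar>)" using assms(2) by (simp add: dominated_def)
    show "bdd_below (f ` {x..y})" using x y by (intro bdd_below_f) auto
  qed (use x y w_increment near fc_at_TU[OF assms(3)] c_pos in auto)
qed

lemma dominated_TU: "TU f a b c k = ereal x \<Longrightarrow> dominated x"
proof (induction k arbitrary: x)
  case 0
  then show ?case by (rule dominated_TU_0)
next
  case (Suc k)
  \<comment> \<open>Finiteness travels backwards through the interlaced times; the invariant then
    travels forwards through one upper and one lower phase.\<close>
  have "TD f a b c k < \<infinity>" using TD_le_TU_Suc[of f a b c k] Suc.prems by auto
  then obtain y where y: "TD f a b c k = ereal y" using TD_real by blast
  then have "TU f a b c k < \<infinity>" using TU_le_TD[of f a b c k] by auto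
  then obtain z where z: "TU f a b c k = ereal z" using TU_real by blast
  show ?case
    using dominated_TU_Suc[OF y dominated_TD[OF z Suc.IH[OF z] y] Suc.prems] .
qed

lemma dominated_after_TU_0:
  assumes "TU f a b c 0 \<le> ereal s" "s \<le> b"
  shows "dominated s"
proof -
  obtain k where "in_upper f a b c s k \<or> in_lower f a b c s k" using ex_phase[OF assms] .
  then show ?thesis
  proof
    assume up: "in_upper f a b c s k"
    then have "TU f a b c k < \<infinity>" by (auto simp: in_upper_def)
    then obtain x where "TU f a b c k = ereal x" using TU_real by blast
    then show ?thesis using dominated_upper dominated_TU up assms(2) by blast
  next
    assume lo: "in_lower f a b c s k"
    then have "TD f a b c k < \<infinity>" by (auto simp: in_lower_def)
    then obtain y where y: "TD f a b c k = ereal y" using TD_real by blast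
    then have "TU f a b c k < \<infinity>" using TU_le_TD[of f a b c k] by auto
    then obtain x where "TU f a b c k = ereal x" using TU_real by blast
    then show ?thesis using dominated_lower[OF y] dominated_TD dominated_TU y lo assms(2) by blast
  qed
qed

section \<open>Optimality and uniqueness from the invariant\<close>

lemma TV_g_eq: "s \<in> {a..b} \<Longrightarrow> TV g a s = ereal (w s)"
  unfolding w_def using TV_finite[OF TV_fin] by simp

lemma optimal:
  assumes "s \<in> {a..b}"
  shows "TV h a s \<le> TV g a s"
proof (cases "ereal s < TU f a b c 0")
  case True
  then show ?thesis using TV_fc_initial[of s] TV_nonneg[of a s g] assms by auto
next
  case False
  then have "TV h a s \<le> ereal (w s - \<bar>g s - h s\<bar>)"
    using dominated_after_TU_0[of s] assms by (auto simp: dominated_def)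
  also have "\<dots> \<le> ereal (w s)" by simp
  finally show ?thesis using TV_g_eq[OF assms] by simp
qed

lemma unique_after_TU_0:
  assumes "s \<in> {a..b}" "TU f a b c 0 \<le> ereal s" "TV g a s \<le> TV h a s"
  shows "g s = h s"
proof -
  have "ereal (w s) \<le> ereal (w s - \<bar>g s - h s\<bar>)"
    using dominated_after_TU_0[of s] assms TV_g_eq[of s] order_trans
    unfolding dominated_def by (metis atLeastAtMost_iff)
  then show ?thesis by simp
qed

text \<open>Here \<open>g\<close> and \<open>h\<close> are both constant, so only their levels must
  agree. Being near \<open>f\<close> close to its infimum keeps \<open>g\<close> from lying above
  \<open>h\<close>; the first jump, or the oscillation of \<open>f\<close> if there is no jump,
  keeps it from lying below.\<close>

lemma unique_initial:
  assumes le: "\<And>t. t \<in> {a..b} \<Longrightarrow> TV g a t \<le> TV h a t"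
    and osc: "ereal c \<le> (SUP (s, u)\<in>{a..b} \<times> {a..b}. ereal \<bar>f s - f u\<bar>)"
    and s: "s \<in> {a..b}" "ereal s < TU f a b c 0"
  shows "g s = h s"
proof -
  have const: "g t = g a" if "t \<in> {a..b}" "ereal t < TU f a b c 0" for t
  proof -
    have "w t \<le> 0" using le[OF that(1)] TV_fc_initial[of t] TV_g_eq[of t] that by simp
    then show ?thesis using w_increment[of a t] w_nonneg[of a] that by auto
  qed
  have hs: "h s = m_zero f a b c + c / 2" using fc_initial[of s] s by auto
  have "g a \<le> m_zero f a b c + c / 2"
  proof (rule field_le_epsilon)
    fix e :: real assume "e > 0"
    then obtain u where u: "u \<in> {a..b}" "ereal u < TU f a b c 0" "f u < m_zero f a b c + e"
      by (rule m_zero_approx)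
    then show "g a \<le> m_zero f a b c + c / 2 + e" using const[of u] near[of u] by auto
  qed
  moreover have "m_zero f a b c + c / 2 \<le> g a"
  proof (cases "TU f a b c 0 < \<infinity>")
    case True
    then obtain x where x: "TU f a b c 0 = ereal x" "a < x" "x \<le> b" using TU_real by blast
    have "g x = h x" using unique_after_TU_0[of x] le[of x] x by (auto simp del: TU.simps)
    \<comment> \<open>\<open>g\<close> may vary by at most the jump of \<open>h\<close> yet must
      reach \<open>h x\<close>, so it cannot start below \<open>h a\<close>.\<close>
    have "ereal (w x) \<le> ereal (h x - h a)"
      using TV_fc_TU_0_le[OF x(1)] le[of x] TV_g_eq[of x] x
      by (metis atLeastAtMost_iff less_imp_le order_trans)
    then show ?thesis
      using fc_initial[of a] x w_increment[of a x] w_nonneg[of a] \<open>g x = h x\<close> by auto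
  next
    case False
    \<comment> \<open>Now \<open>g\<close> is constant on all of [a;b], and the oscillation yields a
      point \<open>r\<close> with \<open>f r\<close> above \<open>m_zero + c - e\<close>; the tube
      at \<open>r\<close> bounds \<open>g a\<close> from below.\<close>
    then have all: "ereal t < TU f a b c 0" for t by (simp add: top.not_eq_extremum)
    show ?thesis
    proof (rule field_le_epsilon)
      fix e :: real assume "e > 0"
      then have "ereal (c - e) < (SUP (s, u)\<in>{a..b} \<times> {a..b}. ereal \<bar>f s - f u\<bar>)"
        using osc by (meson diff_less_eq ereal_less(2) less_add_same_cancel1 less_ereal.simps(1) order_less_le_trans)
      then obtain p q where "p \<in> {a..b}" "q \<in> {a..b}" "c - e < \<bar>f p - f q\<bar>"
        unfolding less_SUP_iff by auto
      then obtain r t where "r \<in> {a..b}" "t \<in> {a..b}" "c - e < f r - f t"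
        by (cases "f q \<le> f p") auto
      then show "m_zero f a b c + c / 2 \<le> g a + e"
        using m_zero_le[of t] all const[of r] near[of r] by auto
    qed
  qed
  ultimately show ?thesis using hs const[OF s] by simp
qed

lemma optimal_and_unique:
  "(\<forall>s\<in>{a..b}. TV g a s \<ge> TV h a s) \<and>
    ((\<forall>s\<in>{a..b}. TV g a s \<le> TV h a s) \<and>
     ereal c \<le> (SUP (s, u)\<in>{a..b} \<times> {a..b}. ereal \<bar>f s - f u\<bar>) \<longrightarrow>
     (\<forall>s\<in>{a..b}. g s = h s))"
  using optimal unique_after_TU_0 unique_initial by (meson linorder_not_le)

end

theorem corollary3p8:
  fixes f g :: "real \<Rightarrow> real" and a b c :: real
  assumes "a < b" and "cadlag_on a b f" and "c > 0"
    and "sup_norm_on a b (\<lambda>t. f t - g t) \<le> ereal (c / 2)"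
    and "TV g a b < \<infinity>"
  shows "(\<forall>s\<in>{a..b}. TV g a s \<ge> TV (fc f a b c) a s) \<and>
    ((\<forall>s\<in>{a..b}. TV g a s \<le> TV (fc f a b c) a s) \<and>
     ereal c \<le> (SUP (s, u)\<in>{a..b} \<times> {a..b}. ereal \<bar>f s - f u\<bar>) \<longrightarrow>
     (\<forall>s\<in>{a..b}. g s = fc f a b c s))"
proof -
  have near: "g t \<in> {f t - c / 2..f t + c / 2}" if "t \<in> {a..b}" for t
  proof -
    have "\<bar>f t - g t\<bar> \<le> c / 2"
      using assms(4) that unfolding sup_norm_on_def SUP_le_iff by (simp add: ereal_less_eq)
    then show ?thesis unfolding abs_le_iff by simp
  qed
  show ?thesis
  proof (cases "T_D f a b c \<ge> T_U f a b c")
    case True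
    interpret bv_in_tube f g a b c by unfold_locales (use assms near in auto)
    have "fc f a b c = fc_up_first f a b c" using True by (auto simp: fc_def)
    then show ?thesis using optimal_and_unique by simp
  next
    case False
    \<comment> \<open>In this case \<open>fc\<close> is defined by reflection, so the comparison is
      made for the negatives; variation and oscillation are unchanged by the sign.\<close>
    interpret neg: bv_in_tube "\<lambda>t. - f t" "\<lambda>t. - g t" a b c
    proof unfold_locales
      show "cadlag_on a b (\<lambda>t. - f t)"
        unfolding cadlag_on_def
      proof (intro conjI ballI)
        show "((\<lambda>t. - f t) \<longlongrightarrow> - f t) (at_right t)" if "t \<in> {a..<b}" for t
          using assms(2) that unfolding cadlag_on_def by (blast intro: tendsto_minus)
        show "\<exists>l. ((\<lambda>t. - f t) \<longlongrightarrow> l) (at_left t)" if "t \<in> {a<..b}" for t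
          using assms(2) that unfolding cadlag_on_def by (blast intro: tendsto_minus)
      qed
      show "- g t \<in> {- f t - c / 2..- f t + c / 2}" if "t \<in> {a..b}" for t using near[OF that] by auto
    qed (use assms in \<open>auto simp: TV_uminus\<close>)
    have fc: "fc f a b c = (\<lambda>s. - fc_up_first (\<lambda>t. - f t) a b c s)"
      using False by (auto simp: fc_def)
    have "\<bar>- f s - - f u\<bar> = \<bar>f s - f u\<bar>" for s u by simp
    then show ?thesis using neg.optimal_and_unique unfolding fc TV_uminus
      by (simp add: minus_equation_iff[of "g _"] eq_commute)
  qed
qed

end
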